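(* Let $\mathbb{A}=(A,\vee,\wedge,c,0,1)$ be a Nelson algebra whose underlying lattice $A$ is algebraic. Then there exist a set $U$ and a quasiorder $R$ on $U$ such that $\mathbb{A}\cong\mathbb{RS}$, where $\mathbb{RS}$ is the algebra of rough sets determined by $R$.
   Context: Algebraic lattice: a complete lattice in which every element is a join of compact elements. Quasiorder: a reflexive and transitive binary relation. A De Morgan algebra $(A,\vee,\wedge,c,0,1)$ is a bounded distributive lattice with least element $0$ and greatest element $1$, with a unary operation $c$ such that for all $x,y\in A$: $c(c(x))=x$, and $x\le y$ iff $c(x)\ge c(y)$. A Kleene algebra is a De Morgan algebra with $x\wedge c(x)\le y\vee c(y)$ for all $x,y$. For elements $a,b$ of a lattice, the relative pseudocomplement $a\Rightarrow b$ is the greatest $x$ with $a\wedge x\le b$ (if it exists). A quasi-Nelson algebra is a Kleene algebra in which $a\Rightarrow(c(a)\vee b)$ exists for all $a,b$; one writes $a\to b$ for $a\Rightarrow(c(a)\vee b)$. A Nelson algebra is a quasi-Nelson algebra satisfying $(a\wedge b)\to d=a\to(b\to d)$ for all $a,b,d$. Rough sets: for a binary relation $R$ on $U$, put $R(x)=\{y\in U\mid x\,R\,y\}$, and for $X\subseteq U$ put $X^{\blacktriangledown}=\{x\in U\mid R(x)\subseteq X\}$, $X^{\blacktriangle}=\{x\in U\mid R(x)\cap X\ne\emptyset\}$, $\mathcal{A}(X)=(X^{\blacktriangledown},X^{\blacktriangle})$. Let $RS=\{\mathcal{A}(X)\mid X\subseteq U\}$, ordered by coordinatewise inclusion. When $R$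 is a quasiorder, it is known that $RS$ is a complete sublattice of $\wp(U)\times\wp(U)$ (so joins and meets are coordinatewise unions and intersections), and that $\mathbb{RS}=(RS,\vee,\wedge,c,(\emptyset,\emptyset),(U,U))$ with $c(\mathcal{A}(X))=\mathcal{A}(U\setminus X)$ is a (well-defined) De Morgan algebra. The symbol $\cong$ denotes isomorphism of algebras with respect to $\vee,\wedge,c,0,1$ (hence also with respect to $\to$, which is determined by these). *)

theory Defs
  imports "HOL-Library.Product_Order"
begin

definition compact_element :: "'a::complete_lattice \<Rightarrow> bool" where
  "compact_element k \<longleftrightarrow>
     (\<forall>S. k \<le> Sup S \<longrightarrow> (\<exists>F. finite F \<and> F \<subseteq> S \<and> k \<le> Sup F))"

text \<open>The type argument is the lattice; its elements are the whole type.\<close>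

definition algebraic_lattice :: "'a::complete_lattice itself \<Rightarrow> bool" where
  "algebraic_lattice _ \<longleftrightarrow>
     (\<forall>x::'a. \<exists>K. (\<forall>k\<in>K. compact_element k) \<and> x = Sup K)"

locale de_morgan_algebra =
  fixes c :: "'a::{bounded_lattice, distrib_lattice} \<Rightarrow> 'a"
  assumes c_c: "c (c x) = x"
    and c_antitone: "x \<le> y \<longleftrightarrow> c x \<ge> c y"

locale kleene_algebra = de_morgan_algebra +
  assumes kleene: "inf x (c x) \<le> sup y (c y)"

definition is_rel_pseudocomplement :: "'a::lattice \<Rightarrow> 'a \<Rightarrow> 'a \<Rightarrow> bool" where
  "is_rel_pseudocomplement a b x \<longleftrightarrow>
     inf a x \<le> b \<and> (\<forall>y. inf a y \<le> b \<longrightarrow> y \<le> x)"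

text \<open>Meaningful only where the relative pseudocomplement exists.\<close>

definition rel_pseudocomplement :: "'a::lattice \<Rightarrow> 'a \<Rightarrow> 'a" where
  "rel_pseudocomplement a b = (THE x. is_rel_pseudocomplement a b x)"

locale quasi_nelson_algebra = kleene_algebra +
  assumes rel_pseudocomplement_exists:
    "\<exists>x. is_rel_pseudocomplement a (sup (c a) b) x"
begin

definition nelson_imp :: "'a \<Rightarrow> 'a \<Rightarrow> 'a" where
  "nelson_imp a b = rel_pseudocomplement a (sup (c a) b)"

end

locale nelson_algebra = quasi_nelson_algebra +
  assumes nelson: "nelson_imp (inf a b) d = nelson_imp a (nelson_imp b d)"

definition lower_approx :: "'u set \<Rightarrow> 'u rel \<Rightarrow> 'u set \<Rightarrow> 'u set" where
  "lower_approx U R X = {x \<in> U. R `` {x} \<subseteq> X}"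

definition upper_approx :: "'u set \<Rightarrow> 'u rel \<Rightarrow> 'u set \<Rightarrow> 'u set" where
  "upper_approx U R X = {x \<in> U. R `` {x} \<inter> X \<noteq> {}}"

definition rough_set :: "'u set \<Rightarrow> 'u rel \<Rightarrow> 'u set \<Rightarrow> 'u set \<times> 'u set" where
  "rough_set U R X = (lower_approx U R X, upper_approx U R X)"

definition RS :: "'u set \<Rightarrow> 'u rel \<Rightarrow> ('u set \<times> 'u set) set" where
  "RS U R = {rough_set U R X | X. X \<subseteq> U}"

definition rs_neg :: "'u set \<Rightarrow> 'u rel \<Rightarrow> 'u set \<times> 'u set \<Rightarrow> 'u set \<times> 'u set" where
  "rs_neg U R p =
     (THE q. \<exists>X. X \<subseteq> U \<and> p = rough_set U R X \<and> q = rough_set U R (U - X))"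

lemma rs_neg_rough_set:
  assumes "R \<subseteq> U \<times> U" "X \<subseteq> U"
  shows "rs_neg U R (rough_set U R X) = rough_set U R (U - X)"
proof -
  have *: "rough_set U R (U - Y) = (U - upper_approx U R Y, U - lower_approx U R Y)"
    if "Y \<subseteq> U" for Y
    using assms(1) that
    unfolding rough_set_def lower_approx_def upper_approx_def by auto
  show ?thesis
    unfolding rs_neg_def
  proof (rule the_equality)
    show "\<exists>Y. Y \<subseteq> U \<and> rough_set U R X = rough_set U R Y \<and>
            rough_set U R (U - X) = rough_set U R (U - Y)"
      using assms(2) by blast
  next
    fix q
    assume "\<exists>Y. Y \<subseteq> U \<and> rough_set U R X = rough_set U R Y \<and> q = rough_set U R (U - Y)"
    then show "q = rough_set U R (U - X)"
      using * assms(2) by (auto simp: rough_set_def)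
  qed
qed

text \<open>
  Here sup and inf on pairs are those of Product_Order, that is, coordinatewise union and
  intersection. These are the lattice operations of RS, which for a quasiorder is a complete
  sublattice of the product of two copies of the powerset of U.
\<close>

definition rs_isomorphism ::
  "('a::{bounded_lattice, distrib_lattice} \<Rightarrow> 'a) \<Rightarrow> 'u set \<Rightarrow> 'u rel
     \<Rightarrow> ('a \<Rightarrow> 'u set \<times> 'u set) \<Rightarrow> bool" where
  "rs_isomorphism c U R h \<longleftrightarrow>
     bij_betw h UNIV (RS U R) \<and>
     (\<forall>x y. h (sup x y) = sup (h x) (h y)) \<and>
     (\<forall>x y. h (inf x y) = inf (h x) (h y)) \<and>
     (\<forall>x. h (c x) = rs_neg U R (h x)) \<and>
     h bot = ({}, {}) \<and>
     h top = (U, U)"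

end

theory Submission
  imports Defs
begin

text \<open>
  The points of the approximation space are the completely join-prime elements of the algebra.

  The negation \<open>c\<close> is a dual automorphism, so an algebraic De Morgan algebra is also dually
  algebraic.  Being distributive, it has enough completely join-prime elements to separate its
  elements (\<open>spatial\<close>).  Write \<open>J\<close> for the set of these elements.  Negation is visible on \<open>J\<close> as an
  order-reversing involution \<open>g\<close>, linked to \<open>c\<close> by the rule that \<open>g j \<le> x\<close> iff \<open>j\<close> is not
  below \<open>c x\<close>.  The Kleene law says that \<open>j\<close> and \<open>g j\<close> are comparable (\<open>mirror_comparable\<close>), so \<open>J\<close>
  falls into pairs consisting of a lower point and its mirror image, which may coincide.

  The quasiorder on \<open>J\<close> compares the lower points of the pairs.  The two members of a pair become
  equivalent, and this produces exactly the classes that rough sets need: a pair with two members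
  can be cut by a set, while a pair collapsed to one point is a maximal class with a single element,
  on which the lower and the upper approximation agree.  An element \<open>x\<close> is sent to the rough set whose
  upper approximation records the pairs whose lower member is below \<open>x\<close>, and whose lower
  approximation records the pairs whose upper member is below \<open>x\<close>.

  This map is an embedding in every algebraic Kleene algebra.  Surjectivity is where the
  Nelson law enters.  The element realising a pair \<open>(A, B)\<close> has to be the join of the lower points
  of \<open>B\<close> and the upper points of \<open>A\<close>, and one must exclude that this join picks up further lower
  points through the upper points of \<open>A\<close>.  That is the interpolation property
  (\<open>interpolation\<close>): if \<open>p\<close> and \<open>q\<close> both lie below \<open>g p\<close> and \<open>g q\<close>, then some \<open>k\<close> in \<open>J\<close> lies
  between.  It follows from the Nelson law for \<open>a = g p\<close>, \<open>b = g q\<close> and \<open>d = \<bottom>\<close>.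
\<close>

section \<open>Negation of rough sets\<close>

lemma rs_neg_RS:
  assumes "R \<subseteq> U \<times> U" "(A, B) \<in> RS U R"
  shows "rs_neg U R (A, B) = (U - B, U - A)"
proof -
  obtain X where X: "X \<subseteq> U" "(A, B) = rough_set U R X" using assms(2) by (auto simp: RS_def)
  have "rs_neg U R (A, B) = rough_set U R (U - X)"
    unfolding X(2) by (rule rs_neg_rough_set[OF assms(1) X(1)])
  also have "\<dots> = (U - B, U - A)"
    using X assms(1) by (auto simp: rough_set_def lower_approx_def upper_approx_def)
  finally show ?thesis .
qed

section \<open>Distributive algebraic lattices\<close>

lemma algebraic_le_iff:
  fixes x y :: "'a::complete_lattice"
  assumes "algebraic_lattice TYPE('a)"
  shows "x \<le> y \<longleftrightarrow> (\<forall>k. compact_element k \<and> k \<le> x \<longrightarrow> k \<le> y)"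
proof
  assume *: "\<forall>k. compact_element k \<and> k \<le> x \<longrightarrow> k \<le> y"
  obtain K where K: "\<forall>k\<in>K. compact_element k" and x: "x = Sup K"
    using assms unfolding algebraic_lattice_def by blast
  show "x \<le> y"
    unfolding x by (rule Sup_least) (use * K x in \<open>auto intro: Sup_upper\<close>)
qed (auto intro: order_trans)

text \<open>
  A compact element below \<open>x \<sqinter> \<Squnion> S\<close> is below the join of a finite part of \<open>S\<close>, and for finite
  joins ordinary distributivity suffices.
\<close>

lemma inf_Sup_le_algebraic:
  fixes x :: "'a::{complete_lattice, distrib_lattice}"
  assumes "algebraic_lattice TYPE('a)"
  shows "inf x (Sup S) \<le> (SUP s\<in>S. inf x s)"
proof -
  have fin: "inf x (Sup F) \<le> (SUP s\<in>F. inf x s)" if "finite F" for F :: "'a set"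
    using that
  proof (induction F)
    case (insert s F)
    then show ?case
      by (auto simp: inf_sup_distrib1 intro: le_supI2)
  qed simp
  show ?thesis
  proof (rule iffD2[OF algebraic_le_iff[OF assms]], intro allI impI)
    fix k :: 'a
    assume k: "compact_element k \<and> k \<le> inf x (Sup S)"
    then have "k \<le> Sup S" by simp
    then obtain F where F: "finite F" "F \<subseteq> S" "k \<le> Sup F"
      using k unfolding compact_element_def by blast
    have "k \<le> inf x (Sup F)" using k F(3) by simp
    also have "\<dots> \<le> (SUP s\<in>F. inf x s)" by (rule fin[OF F(1)])
    also have "\<dots> \<le> (SUP s\<in>S. inf x s)" using F(2) by (intro SUP_subset_mono) auto
    finally show "k \<le> (SUP s\<in>S. inf x s)" .
  qed
qed

text \<open>
  Compactness of \<open>k\<close> makes the elements avoiding \<open>k\<close> closed under joins of nonempty chains, so that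
  Zorn's lemma applies.
\<close>

lemma compact_maximal_avoiding:
  fixes k x :: "'a::complete_lattice"
  assumes k: "compact_element k" and "\<not> k \<le> x"
  obtains m where "x \<le> m" "\<not> k \<le> m" "\<And>z. m < z \<Longrightarrow> k \<le> z"
proof -
  define Z where "Z = {z. x \<le> z \<and> \<not> k \<le> z}"
  have ub: "\<exists>u\<in>Z. \<forall>z\<in>C. z \<le> u"
    if C: "C \<subseteq> Z" "\<forall>y\<in>C. \<forall>z\<in>C. y \<le> z \<or> z \<le> y" for C
  proof (cases "C = {}")
    case True
    then show ?thesis using assms by (auto simp: Z_def)
  next
    case False
    have fin: "\<exists>u\<in>C. Sup F \<le> u" if "finite F" "F \<subseteq> C" for F
      using that
    proof (induction F)
      case empty
      then show ?case using False by auto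
    next
      case (insert s F)
      then obtain u where "u \<in> C" "Sup F \<le> u" by auto
      then show ?case using insert.prems C(2) by (metis Sup_insert insert_subset le_sup_iff order.refl order.trans)
    qed
    have "\<not> k \<le> Sup C"
    proof
      assume "k \<le> Sup C"
      then obtain F where "finite F" "F \<subseteq> C" "k \<le> Sup F"
        using k unfolding compact_element_def by blast
      then obtain u where "u \<in> C" "k \<le> u" using fin order_trans by blast
      then show False using C(1) by (auto simp: Z_def)
    qed
    moreover have "x \<le> Sup C"
      using False C(1) by (auto simp: Z_def intro: order_trans Sup_upper)
    ultimately have "Sup C \<in> Z" by (simp add: Z_def)
    then show ?thesis using Sup_upper by blast
  qed
  have "\<exists>m\<in>Z. \<forall>z\<in>Z. m \<le> z \<longrightarrow> z = m"
  proof (rule predicate_Zorn)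
    show "partial_order_on Z (relation_of (\<le>) Z)"
      by (rule partial_order_on_relation_ofI) auto
    fix C assume "C \<in> Chains (relation_of (\<le>) Z)"
    then have "C \<subseteq> Z" "\<forall>y\<in>C. \<forall>z\<in>C. y \<le> z \<or> z \<le> y"
      unfolding Chains_def relation_of_def by auto
    then show "\<exists>u\<in>Z. \<forall>z\<in>C. z \<le> u" by (rule ub)
  qed
  then obtain m where "m \<in> Z" and max: "\<And>z. z \<in> Z \<Longrightarrow> m \<le> z \<Longrightarrow> z = m" by blast
  then show ?thesis
    by (intro that[of m]) (auto simp: Z_def less_le dest: order_trans)
qed

section \<open>Completely join-prime elements of an algebraic De Morgan algebra\<close>

definition completely_join_prime :: "'a::complete_lattice \<Rightarrow> bool" where
  "completely_join_prime j \<longleftrightarrow> (\<forall>S. j \<le> Sup S \<longrightarrow> (\<exists>s\<in>S. j \<le> s))"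

lemma completely_join_prime_Sup:
  "completely_join_prime j \<Longrightarrow> j \<le> Sup S \<longleftrightarrow> (\<exists>s\<in>S. j \<le> s)"
  unfolding completely_join_prime_def by (meson Sup_upper2)

lemma completely_join_prime_sup:
  "completely_join_prime j \<Longrightarrow> j \<le> sup x y \<longleftrightarrow> j \<le> x \<or> j \<le> y"
  using completely_join_prime_Sup[of j "{x, y}"] by simp

lemma completely_join_prime_bot: "completely_join_prime j \<Longrightarrow> \<not> j \<le> bot"
  using completely_join_prime_Sup[of j "{}"] by simp

locale algebraic_de_morgan = de_morgan_algebra c
  for c :: "'a::{complete_lattice, distrib_lattice} \<Rightarrow> 'a" +
  assumes algebraic: "algebraic_lattice TYPE('a)"
begin

lemma c_le_swap: "c x \<le> y \<longleftrightarrow> c y \<le> x"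
  using c_antitone[of "c x" y] by (simp add: c_c)

lemma le_c_swap: "x \<le> c y \<longleftrightarrow> y \<le> c x"
  using c_antitone[of x "c y"] by (simp add: c_c)

lemma c_Sup: "c (Sup S) = (INF s\<in>S. c s)"
proof (rule order.antisym)
  show "c (Sup S) \<le> (INF s\<in>S. c s)"
    by (rule INF_greatest) (use c_antitone Sup_upper in blast)
  have "Sup S \<le> c (INF s\<in>S. c s)"
    by (rule Sup_least, subst le_c_swap) (rule INF_lower)
  then show "(INF s\<in>S. c s) \<le> c (Sup S)" using le_c_swap by blast
qed

lemma c_sup: "c (sup x y) = inf (c x) (c y)"
  using c_Sup[of "{x, y}"] by simp

lemma c_inf: "c (inf x y) = sup (c x) (c y)"
  by (metis c_sup c_c)

lemma c_Inf: "c (Inf S) = (SUP s\<in>S. c s)"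
proof -
  have "c (SUP s\<in>S. c s) = Inf S"
    unfolding c_Sup by (simp add: image_image c_c)
  then show ?thesis by (metis c_c)
qed

lemma Inf_sup_le:
  fixes x :: 'a
  shows "(INF s\<in>S. sup x s) \<le> sup x (Inf S)"
proof -
  have "inf (c x) (Sup (c ` S)) \<le> (SUP s\<in>c ` S. inf (c x) s)"
    by (rule inf_Sup_le_algebraic[OF algebraic])
  then have "c (sup x (Inf S)) \<le> c (INF s\<in>S. sup x s)"
    by (simp add: c_sup c_Inf image_image)
  then show ?thesis using c_antitone by blast
qed

text \<open>
  An element maximal with respect to avoiding a compact element is completely meet-prime, because
  infima distribute over joins; its negation is then completely join-prime.  Separating \<open>c y\<close> from
  \<open>c x\<close> by a compact element therefore separates \<open>x\<close> from \<open>y\<close> by a completely join-prime one.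
\<close>

lemma spatial:
  fixes x y :: 'a
  assumes "\<And>j. completely_join_prime j \<Longrightarrow> j \<le> x \<Longrightarrow> j \<le> y"
  shows "x \<le> y"
proof (rule ccontr)
  assume "\<not> x \<le> y"
  then have "\<not> c y \<le> c x" using c_antitone[of x y] by blast
  then obtain k where k: "compact_element k" "k \<le> c y" "\<not> k \<le> c x"
    using algebraic_le_iff[OF algebraic, of "c y" "c x"] by blast
  obtain m where m: "c x \<le> m" "\<not> k \<le> m" and max: "\<And>z. m < z \<Longrightarrow> k \<le> z"
    by (rule compact_maximal_avoiding[OF k(1,3)]) blast
  have "completely_join_prime (c m)"
    unfolding completely_join_prime_def
  proof (intro allI impI, rule ccontr)
    fix S assume "c m \<le> Sup S" and no: "\<not> (\<exists>s\<in>S. c m \<le> s)"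
    then have "c (Sup S) \<le> m" using c_le_swap[of m "Sup S"] by blast
    then have Inf: "(INF s\<in>S. c s) \<le> m" by (simp only: c_Sup)
    have "k \<le> sup m (c s)" if "s \<in> S" for s
    proof (rule max)
      have "\<not> c s \<le> m" using no that c_le_swap[of s m] by blast
      then show "m < sup m (c s)" by (simp add: less_le_not_le)
    qed
    then have "k \<le> (INF s\<in>c ` S. sup m s)" by (intro INF_greatest) blast
    also have "\<dots> \<le> sup m (INF s\<in>S. c s)" by (rule Inf_sup_le)
    also have "\<dots> = m" using Inf by (simp add: sup.absorb1)
    finally show False using m(2) by blast
  qed
  moreover have "c m \<le> x" using m(1) c_le_swap[of x m] by blast
  ultimately have "c m \<le> y" using assms by blast
  then have "c y \<le> m" using c_le_swap[of m y] by blast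
  then show False using k(2) m(2) order_trans by blast
qed

text \<open>
  On completely join-prime elements the negation becomes an operation \<open>g\<close>: as \<open>c j\<close> is completely
  meet-prime, the elements not below \<open>c j\<close> form a principal filter, generated by \<open>g j\<close>.
\<close>

definition mirror :: "'a \<Rightarrow> 'a" ("g") where
  "g j = Inf {x. \<not> x \<le> c j}"

lemma mirror_le_iff:
  assumes "completely_join_prime j"
  shows "g j \<le> x \<longleftrightarrow> \<not> j \<le> c x"
proof -
  have "\<not> g j \<le> c j"
  proof
    assume "g j \<le> c j"
    then have "j \<le> (SUP x\<in>{x. \<not> x \<le> c j}. c x)"
      unfolding mirror_def by (subst (asm) le_c_swap) (simp add: c_Inf)
    then obtain x where "\<not> x \<le> c j" "j \<le> c x"
      using completely_join_prime_Sup[OF assms] by auto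
    then show False using le_c_swap[of x j] by blast
  qed
  moreover have "g j \<le> x" if "\<not> x \<le> c j"
    unfolding mirror_def using that by (intro Inf_lower) simp
  ultimately show ?thesis
    using le_c_swap[of j x] order_trans by blast
qed

lemma le_c_iff: "completely_join_prime j \<Longrightarrow> j \<le> c x \<longleftrightarrow> \<not> g j \<le> x"
  by (simp add: mirror_le_iff)

lemma mirror_prime:
  assumes "completely_join_prime j"
  shows "completely_join_prime (g j)"
  unfolding completely_join_prime_def
proof (intro allI impI)
  fix S assume "g j \<le> Sup S"
  then have "\<not> Sup S \<le> c j" using mirror_le_iff[OF assms] le_c_swap by blast
  then obtain s where "s \<in> S" "\<not> s \<le> c j" using Sup_least by blast
  then show "\<exists>s\<in>S. g j \<le> s" using mirror_le_iff[OF assms] le_c_swap by blast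
qed

lemma mirror_mirror:
  assumes "completely_join_prime j"
  shows "g (g j) = j"
proof -
  have "g (g j) \<le> x \<longleftrightarrow> j \<le> x" for x
    using mirror_le_iff[OF mirror_prime[OF assms], of x] mirror_le_iff[OF assms, of "c x"]
    by (simp add: c_c)
  then show ?thesis by (metis order.antisym order.refl)
qed

lemma mirror_le_swap:
  assumes "completely_join_prime j" "completely_join_prime k"
  shows "g j \<le> k \<longleftrightarrow> g k \<le> j"
  using mirror_le_iff[OF assms(1), of k] mirror_le_iff[OF assms(2), of j] le_c_swap by blast

lemma mirror_antitone:
  assumes "completely_join_prime j" "completely_join_prime k"
  shows "g j \<le> g k \<longleftrightarrow> k \<le> j"
  using mirror_le_swap[OF assms(1) mirror_prime[OF assms(2)]] mirror_mirror[OF assms(2)] by simp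

lemma le_mirror_swap:
  assumes "completely_join_prime j" "completely_join_prime k"
  shows "j \<le> g k \<longleftrightarrow> k \<le> g j"
  using mirror_antitone[OF mirror_prime[OF assms(1)] assms(2)] mirror_mirror[OF assms(1)] by simp

end

section \<open>The Kleene law on prime elements\<close>

locale algebraic_kleene = algebraic_de_morgan c + kleene_algebra c
  for c :: "'a::{complete_lattice, distrib_lattice} \<Rightarrow> 'a"
begin

text \<open>
  If \<open>g j\<close> is not below \<open>j\<close>, then \<open>j \<le> c j\<close>, so the Kleene law puts \<open>j = j \<sqinter> c j\<close> below
  \<open>g j \<squnion> c (g j)\<close>; but a prime element is never below the negation of its mirror image.
\<close>

lemma mirror_comparable:
  assumes j: "completely_join_prime j"
  shows "j \<le> g j \<or> g j \<le> j"
proof (rule disjCI)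
  assume "\<not> g j \<le> j"
  then have "j \<le> c j" using mirror_le_iff[OF j] by blast
  then have "j \<le> inf j (c j)" by simp
  also have "\<dots> \<le> sup (g j) (c (g j))" by (rule kleene)
  finally show "j \<le> g j"
    using le_c_iff[OF j, of "g j"] completely_join_prime_sup[OF j] by auto
qed

definition lo :: "'a \<Rightarrow> 'a" where
  "lo j = inf j (g j)"

lemma lo_cases:
  assumes "completely_join_prime j"
  obtains "lo j = j" "j \<le> g j" | "lo j = g j" "g j \<le> j"
  using mirror_comparable[OF assms] unfolding lo_def by (meson inf.absorb1 inf.absorb2)

lemma lo_prime: "completely_join_prime j \<Longrightarrow> completely_join_prime (lo j)"
  by (metis lo_cases mirror_prime)

lemma lo_le_mirror:
  assumes "completely_join_prime j" shows "lo j \<le> g (lo j)"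
  using lo_cases[OF assms] mirror_mirror[OF assms] by metis

lemma lo_eq: "j \<le> g j \<Longrightarrow> lo j = j"
  by (simp add: lo_def inf.absorb1)

lemma lo_lo: "completely_join_prime j \<Longrightarrow> lo (lo j) = lo j"
  by (simp add: lo_eq lo_le_mirror)

lemma lo_mirror: "completely_join_prime j \<Longrightarrow> lo (g j) = lo j"
  by (simp add: lo_def mirror_mirror inf_commute)


section \<open>The approximation space and the isomorphism\<close>

definition points :: "'a set" where
  "points = {j. completely_join_prime j}"

definition point_rel :: "'a rel" where
  "point_rel = {(j, k). j \<in> points \<and> k \<in> points \<and> lo j \<le> lo k}"

definition rep :: "'a \<Rightarrow> 'a set \<times> 'a set" where
  "rep x = ({j \<in> points. g (lo j) \<le> x}, {j \<in> points. lo j \<le> x})"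

lemma preorder_point_rel: "preorder_on points point_rel"
  unfolding preorder_on_def point_rel_def
  by (auto simp: refl_on_def intro!: transI)

text \<open>
  The last condition says that the approximations agree on the points with a one-element
  neighbourhood, which are the points fixed by \<open>g\<close>.  Conversely, a pair meeting the conditions is
  approximated by a set that contains \<open>A\<close> and, of each two-element class inside \<open>B\<close> but outside \<open>A\<close>,
  one member; the lower one is chosen.
\<close>

lemma RS_points_iff:
  "(A, B) \<in> RS points point_rel \<longleftrightarrow>
     A \<subseteq> B \<and> B \<subseteq> points \<and>
     (\<forall>j\<in>A. \<forall>k\<in>points. lo j \<le> lo k \<longrightarrow> k \<in> A) \<and>
     (\<forall>k\<in>B. \<forall>j\<in>points. lo j \<le> lo k \<longrightarrow> j \<in> B) \<and>
     (\<forall>j\<in>B. g j = j \<longrightarrow> j \<in> A)" (is "?L \<longleftrightarrow> ?R")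
proof
  assume ?L
  then obtain X where X: "X \<subseteq> points"
    and A: "A = {j \<in> points. \<forall>k\<in>points. lo j \<le> lo k \<longrightarrow> k \<in> X}"
    and B: "B = {j \<in> points. \<exists>k\<in>X. lo j \<le> lo k}"
    by (auto simp: RS_def rough_set_def lower_approx_def upper_approx_def point_rel_def)
  have "j \<in> A" if "j \<in> B" "g j = j" for j
  proof -
    \<comment> \<open>Here \<open>j \<le> lo k \<le> g (lo k) \<le> g j = j\<close>, so a fixed point of \<open>g\<close> is its only successor.\<close>
    have single: "k = j" if k: "k \<in> points" "lo j \<le> lo k" for k
    proof -
      have ck: "completely_join_prime k" and cj: "completely_join_prime j"
        using k(1) \<open>j \<in> B\<close> B by (auto simp: points_def)
      have lj: "lo j = j" using \<open>g j = j\<close> by (simp add: lo_def)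
      have "lo k \<le> g (lo k)" by (rule lo_le_mirror[OF ck])
      moreover have "g (lo k) \<le> j"
        using mirror_antitone[OF lo_prime[OF ck] cj] k(2) lj \<open>g j = j\<close> by simp
      ultimately have "lo k = j" "g (lo k) = j" using k(2) lj by auto
      then show "k = j" using lo_cases[OF ck] mirror_mirror[OF ck] by metis
    qed
    then show ?thesis using that(1) X unfolding A B by blast
  qed
  moreover have "A \<subseteq> B" unfolding A B by blast
  ultimately show ?R
    using X unfolding A B by (auto intro: order_trans)
next
  assume R: ?R
  define X where "X = A \<union> {j \<in> B. lo j = j}"
  have "X \<subseteq> points" using R by (auto simp: X_def)
  moreover have "lower_approx points point_rel X = A"
  proof
    show "A \<subseteq> lower_approx points point_rel X"
      using R by (auto simp: lower_approx_def point_rel_def X_def)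
    show "lower_approx points point_rel X \<subseteq> A"
    proof
      fix j assume "j \<in> lower_approx points point_rel X"
      then have j: "j \<in> points" and nb: "\<And>k. k \<in> points \<Longrightarrow> lo j \<le> lo k \<Longrightarrow> k \<in> X"
        by (auto simp: lower_approx_def point_rel_def)
      have cj: "completely_join_prime j" using j by (simp add: points_def)
      have gj: "g j \<in> points" using mirror_prime[OF cj] by (simp add: points_def)
      have "j \<in> X" "g j \<in> X" using nb j gj lo_mirror[OF cj] by auto
      show "j \<in> A"
      proof (rule ccontr)
        assume "j \<notin> A"
        then have "g j \<notin> A" using R j lo_mirror[OF cj] by auto
        then have "lo j = j" "lo (g j) = g j" "j \<in> B"
          using \<open>j \<notin> A\<close> \<open>j \<in> X\<close> \<open>g j \<in> X\<close> by (auto simp: X_def)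
        then have "g j = j" using lo_mirror[OF cj] by simp
        then show False using R \<open>j \<in> B\<close> \<open>j \<notin> A\<close> by blast
      qed
    qed
  qed
  moreover have "upper_approx points point_rel X = B"
  proof
    show "upper_approx points point_rel X \<subseteq> B"
      using R by (auto simp: upper_approx_def point_rel_def X_def)
    show "B \<subseteq> upper_approx points point_rel X"
    proof
      fix j assume j: "j \<in> B"
      then have jp: "j \<in> points" and cj: "completely_join_prime j"
        using R by (auto simp: points_def)
      have lp: "lo j \<in> points" using lo_prime[OF cj] by (simp add: points_def)
      have "lo j \<in> B" using R j lp lo_lo[OF cj] by (metis order.refl)
      then have "lo j \<in> X" by (simp add: X_def lo_lo[OF cj])
      then show "j \<in> upper_approx points point_rel X"
        using jp lp lo_lo[OF cj] by (auto simp: upper_approx_def point_rel_def intro!: exI[of _ "lo j"])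
    qed
  qed
  ultimately show ?L by (auto simp: RS_def rough_set_def)
qed

lemma rep_in_RS: "rep x \<in> RS points point_rel"
  unfolding rep_def RS_points_iff
proof (intro conjI ballI impI)
  fix j k
  assume j: "j \<in> {j \<in> points. g (lo j) \<le> x}" and k: "k \<in> points" and le: "lo j \<le> lo k"
  then have "g (lo k) \<le> g (lo j)"
    by (simp add: mirror_antitone lo_prime points_def)
  then show "k \<in> {j \<in> points. g (lo j) \<le> x}" using j k by auto
next
  show "{j \<in> points. g (lo j) \<le> x} \<subseteq> {j \<in> points. lo j \<le> x}"
    using lo_le_mirror order_trans by (auto simp: points_def)
next
  fix j k
  assume "k \<in> {j \<in> points. lo j \<le> x}" "j \<in> points" "lo j \<le> lo k"
  then show "j \<in> {j \<in> points. lo j \<le> x}" using order_trans by blast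
qed (auto simp: lo_def)

lemma rep_inj: "inj rep"
proof -
  have le: "x \<le> y" if eq: "rep x = rep y" for x y
  proof (rule spatial)
    fix j assume j: "completely_join_prime j" "j \<le> x"
    have P: "j \<in> points" using j(1) by (simp add: points_def)
    have "lo j \<le> x \<longleftrightarrow> lo j \<le> y" "g (lo j) \<le> x \<longleftrightarrow> g (lo j) \<le> y"
      using eq P unfolding rep_def by blast+
    then show "j \<le> y"
      using j(2) lo_cases[OF j(1)] mirror_mirror[OF j(1)] by metis
  qed
  show ?thesis by (rule injI) (metis le order.antisym)
qed

lemma rep_sup: "rep (sup x y) = sup (rep x) (rep y)"
  by (auto simp: rep_def points_def completely_join_prime_sup lo_prime mirror_prime)

lemma rep_inf: "rep (inf x y) = inf (rep x) (rep y)"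
  by (auto simp: rep_def)

lemma rep_c: "rep (c x) = rs_neg points point_rel (rep x)"
proof -
  have "point_rel \<subseteq> points \<times> points" by (auto simp: point_rel_def)
  then have "rs_neg points point_rel (rep x) = (points - snd (rep x), points - fst (rep x))"
    using rs_neg_RS[of point_rel points "fst (rep x)" "snd (rep x)"] rep_in_RS[of x] by simp
  also have "\<dots> = rep (c x)"
    by (auto simp: rep_def points_def le_c_iff lo_prime mirror_prime mirror_mirror)
  finally show ?thesis ..
qed

lemma rep_bot: "rep bot = ({}, {})"
proof -
  have "\<not> lo j \<le> bot" "\<not> g (lo j) \<le> bot" if "j \<in> points" for j
    using that by (simp_all add: points_def completely_join_prime_bot lo_prime mirror_prime
        del: bot_unique)
  then show ?thesis unfolding rep_def by blast
qed

lemma rep_top: "rep top = (points, points)"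
  by (simp add: rep_def)

end

section \<open>Surjectivity from the Nelson law\<close>

context quasi_nelson_algebra
begin

lemma le_nelson_imp_iff: "x \<le> nelson_imp a b \<longleftrightarrow> inf a x \<le> sup (c a) b"
proof -
  obtain y where y: "is_rel_pseudocomplement a (sup (c a) b) y"
    using rel_pseudocomplement_exists by blast
  then have "nelson_imp a b = y"
    unfolding nelson_imp_def rel_pseudocomplement_def
    by (intro the_equality) (auto simp: is_rel_pseudocomplement_def intro: order.antisym)
  then show ?thesis
    using y unfolding is_rel_pseudocomplement_def
    by (meson inf_mono order.refl order_trans)
qed

end

locale algebraic_nelson = algebraic_kleene c + nelson_algebra c
  for c :: "'a::{complete_lattice, distrib_lattice} \<Rightarrow> 'a"
begin

text \<open>
  With \<open>a = g p\<close> and \<open>b = g q\<close>, a prime \<open>k\<close> interpolates iff both \<open>k\<close> and \<open>g k\<close> lie below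
  \<open>a \<sqinter> b\<close>.  If there is none, then \<open>a \<sqinter> b \<le> c (a \<sqinter> b)\<close>, that is, \<open>(a \<sqinter> b) \<rightarrow> \<bottom>\<close> is the top
  element.  The Nelson law makes \<open>a \<rightarrow> (b \<rightarrow> \<bottom>)\<close> the top element as well, and testing this
  with the primes \<open>g p\<close> and \<open>q\<close> gives a contradiction.
\<close>

lemma interpolation:
  fixes p q :: 'a
  assumes p: "completely_join_prime p" and q: "completely_join_prime q"
    and "p \<le> g p" "q \<le> g q" "q \<le> g p"
  shows "\<exists>k. completely_join_prime k \<and> p \<le> k \<and> q \<le> k \<and> k \<le> g p \<and> k \<le> g q"
proof (rule ccontr)
  assume no: "\<not> ?thesis"
  note gp = mirror_prime[OF p] and gq = mirror_prime[OF q]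
  have "inf (g p) (g q) \<le> c (inf (g p) (g q))"
  proof (rule spatial)
    fix k assume k: "completely_join_prime k" and le: "k \<le> inf (g p) (g q)"
    have "\<not> g k \<le> inf (g p) (g q)"
      using no k le mirror_antitone[OF k p] mirror_antitone[OF k q] by auto
    then show "k \<le> c (inf (g p) (g q))" using le_c_iff[OF k] by blast
  qed
  then have "top \<le> nelson_imp (inf (g p) (g q)) bot"
    by (simp add: le_nelson_imp_iff c_inf)
  then have "g p \<le> sup (c (g p)) (nelson_imp (g q) bot)"
    by (simp add: nelson le_nelson_imp_iff flip: top_unique)
  moreover have "\<not> g p \<le> c (g p)"
    using le_c_iff[OF gp, of "g p"] \<open>p \<le> g p\<close> by (simp add: mirror_mirror p)
  ultimately have "inf (g q) (g p) \<le> c (g q)"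
    using completely_join_prime_sup[OF gp] by (simp add: le_nelson_imp_iff)
  then have "q \<le> c (g q)" using \<open>q \<le> g q\<close> \<open>q \<le> g p\<close> by (meson le_infI order_trans)
  then show False using le_c_iff[OF q] by blast
qed

text \<open>
  The preimage is the join of the lower points of \<open>B\<close> and the upper points of \<open>A\<close>.  The delicate
  case is a lower point \<open>lo k\<close> that is below this join only because it is below \<open>g (lo j)\<close> for some
  \<open>j\<close> in \<open>A\<close>.  Interpolation gives a point \<open>m\<close> such that \<open>lo m\<close> is above both \<open>lo j\<close> and \<open>lo k\<close>.
  Since \<open>A\<close> is closed upwards, \<open>m\<close> belongs to \<open>A\<close>, hence to \<open>B\<close>; and since \<open>B\<close> is closed
  downwards, \<open>k\<close> belongs to \<open>B\<close>.
\<close>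

lemma rep_surj:
  assumes "(A, B) \<in> RS points point_rel"
  shows "\<exists>x. rep x = (A, B)"
proof -
  have R: "A \<subseteq> B" "B \<subseteq> points"
    and up: "\<And>j k. j \<in> A \<Longrightarrow> k \<in> points \<Longrightarrow> lo j \<le> lo k \<Longrightarrow> k \<in> A"
    and down: "\<And>j k. k \<in> B \<Longrightarrow> j \<in> points \<Longrightarrow> lo j \<le> lo k \<Longrightarrow> j \<in> B"
    and fixed: "\<And>j. j \<in> B \<Longrightarrow> g j = j \<Longrightarrow> j \<in> A"
    using assms unfolding RS_points_iff by blast+
  have prime: "completely_join_prime j" if "j \<in> B" for j
    using that R(2) by (auto simp: points_def)
  define x where "x = Sup (lo ` B \<union> (\<lambda>j. g (lo j)) ` A)"
  have le_x: "p \<le> x \<longleftrightarrow> (\<exists>j\<in>B. p \<le> lo j) \<or> (\<exists>j\<in>A. p \<le> g (lo j))"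
    if "completely_join_prime p" for p
    unfolding x_def completely_join_prime_Sup[OF that] by blast
  have B: "k \<in> B" if k: "k \<in> points" "lo k \<le> x" for k
  proof -
    have ck: "completely_join_prime k" using k(1) by (simp add: points_def)
    from k(2) consider j where "j \<in> B" "lo k \<le> lo j" | j where "j \<in> A" "lo k \<le> g (lo j)"
      using le_x[OF lo_prime[OF ck]] by blast
    then show ?thesis
    proof cases
      case 1
      then show ?thesis using down k(1) by blast
    next
      case 2
      have cj: "completely_join_prime j" using 2(1) R(1) prime by blast
      obtain m where m: "completely_join_prime m" "lo j \<le> m" "lo k \<le> m" "m \<le> g (lo j)" "m \<le> g (lo k)"
        using interpolation[OF lo_prime[OF cj] lo_prime[OF ck] lo_le_mirror[OF cj]
            lo_le_mirror[OF ck] 2(2)] by blast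
      \<comment> \<open>The conditions on \<open>m\<close> are invariant under \<open>g\<close>, so they hold for \<open>lo m\<close> too.\<close>
      have "lo j \<le> g m" "lo k \<le> g m"
        using m le_mirror_swap[OF m(1) lo_prime[OF cj]] le_mirror_swap[OF m(1) lo_prime[OF ck]]
        by blast+
      then have "lo j \<le> lo m" "lo k \<le> lo m" using m by (simp_all add: lo_def[of m])
      moreover have "m \<in> points" using m(1) by (simp add: points_def)
      ultimately show ?thesis using up[OF 2(1)] R(1) down k(1) by blast
    qed
  qed
  have A: "k \<in> A" if k: "k \<in> points" "g (lo k) \<le> x" for k
  proof -
    have ck: "completely_join_prime k" using k(1) by (simp add: points_def)
    from k(2) consider j where "j \<in> B" "g (lo k) \<le> lo j" | j where "j \<in> A" "g (lo k) \<le> g (lo j)"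
      using le_x[OF mirror_prime[OF lo_prime[OF ck]]] by blast
    then show ?thesis
    proof cases
      case 1
      have cj: "completely_join_prime j" using 1(1) prime by blast
      \<comment> \<open>Here \<open>lo k \<le> g (lo k) \<le> lo j \<le> g (lo j) \<le> lo k\<close>, so \<open>k\<close> is fixed by \<open>g\<close>.\<close>
      have "g (lo j) \<le> lo k"
        using 1(2) mirror_le_swap[OF lo_prime[OF ck] lo_prime[OF cj]] by blast
      then have eq: "g (lo k) = lo k" "lo k = lo j"
        using 1(2) lo_le_mirror[OF ck] lo_le_mirror[OF cj] by auto
      then have "g k = k" using lo_cases[OF ck] mirror_mirror[OF ck] by metis
      moreover have "k \<in> B" using down[OF 1(1) k(1)] eq by simp
      ultimately show ?thesis using fixed by blast
    next
      case 2
      have cj: "completely_join_prime j" using 2(1) R(1) prime by blast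
      then have "lo j \<le> lo k"
        using 2(2) mirror_antitone[OF lo_prime[OF ck] lo_prime[OF cj]] by blast
      then show ?thesis using up[OF 2(1) k(1)] by blast
    qed
  qed
  have "lo j \<le> x" if "j \<in> B" for j unfolding x_def using that by (intro Sup_upper) blast
  moreover have "g (lo j) \<le> x" if "j \<in> A" for j unfolding x_def using that by (intro Sup_upper) blast
  ultimately have "rep x = (A, B)" using A B R unfolding rep_def by blast
  then show ?thesis by blast
qed

lemma rep_isomorphism: "rs_isomorphism c points point_rel rep"
  unfolding rs_isomorphism_def bij_betw_def
  using rep_inj rep_in_RS rep_surj rep_sup rep_inf rep_c rep_bot rep_top
  by (auto simp: image_iff) metis

end

theorem theorem1p1:
  fixes c :: "'a::{complete_lattice, distrib_lattice} \<Rightarrow> 'a"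
  assumes "nelson_algebra c"
    and "algebraic_lattice TYPE('a)"
  shows "\<exists>(U :: 'a set) R h. preorder_on U R \<and> rs_isomorphism c U R h"
proof -
  interpret nelson_algebra c by (rule assms(1))
  interpret algebraic_nelson c by unfold_locales (rule assms(2))
  show ?thesis using preorder_point_rel rep_isomorphism by blast
qed

end
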